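(* Let $T\in\{\mathbb{N},\mathbb{Z},\mathbb{Q},\mathbb{R}\}$, let $S\subseteq T$ be closed under multiplication, and let $\mathcal{F}$ be a filter on $S$. If every set $A\in\mathcal{F}$ is piecewise syndetic in $(S,\cdot)$, then all homogeneous partition regular systems on $S$ are also $\mathcal{F}$-partition regular on $S$.
   Context: Let $\mathbb{K}=\mathbb{R}$ if $T=\mathbb{R}$ and $\mathbb{K}=\mathbb{Q}$ otherwise. A system is a finite list $\sigma=(P_1,\dots,P_m)$ of polynomials $P_i\in\mathbb{K}[x_1,\dots,x_n]$; it is homogeneous if every $P_i$ is homogeneous. $\sigma(a_1,\dots,a_n)=0$ means $P_i(a_1,\dots,a_n)=0$ for all $i\le m$. The system $\sigma(x_1,\dots,x_n)=0$ is partition regular on $S$ if it has a monochromatic solution in every finite coloring of $S\setminus\{0\}$, i.e. for every finite partition $S\setminus\{0\}=A_1\cup\dots\cup A_r$ there are $j\le r$ and $a_1,\dots,a_n\in A_j$ with $\sigma(a_1,\dots,a_n)=0$. The system $\sigma(x_1,\dots,x_n)=0$ is $\mathcal{F}$-partition regular on $S$ if for all $V\in\mathcal{F}$ and all finite partitions $S=A_1\cup\dots\cup A_k$ there exist $j\le k$ and $a_1,\dots,a_n\in A_j\cap V$ such that $\sigma(a_1,\dots,a_n)=0$. A set $A\subseteq S$ is piecewise syndetic in $(S,\cdot)$ if there is a finite nonempty $G\subseteq S$ such that for every finite $H\subseteq S$ there is $x\in S$ with $Hx\subseteq\bigcup_{t\in G}\{y\in S: ty\in A\}$. *)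

theory Defs
  imports Complex_Main "HOL-Library.Poly_Mapping" "HOL-Library.Disjoint_Sets"
begin

text \<open>All of \<open>\<nat> \<subseteq> \<int> \<subseteq> \<rat> \<subseteq> \<real>\<close> are regarded as subsets of the type \<^typ>\<open>real\<close>.
  A polynomial is a finitely supported map from monomials to coefficients, and a
  monomial is a finitely supported map from variable indices to exponents.\<close>

type_synonym mpoly = "(nat \<Rightarrow>\<^sub>0 nat) \<Rightarrow>\<^sub>0 real"

definition polys_over :: "real set \<Rightarrow> nat \<Rightarrow> mpoly set" where
  "polys_over K n =
     {p. (\<forall>m. Poly_Mapping.lookup p m \<in> K) \<and> (\<forall>m\<in>Poly_Mapping.keys p. Poly_Mapping.keys m \<subseteq> {1..n})}"

definition poly_eval :: "mpoly \<Rightarrow> (nat \<Rightarrow> real) \<Rightarrow> real" where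
  "poly_eval p a =
     (\<Sum>m\<in>Poly_Mapping.keys p. Poly_Mapping.lookup p m *
        (\<Prod>i\<in>Poly_Mapping.keys m. a i ^ Poly_Mapping.lookup m i))"

text \<open>The zero polynomial is homogeneous (of every degree).\<close>

definition homogeneous :: "mpoly \<Rightarrow> bool" where
  "homogeneous p \<longleftrightarrow>
     (\<exists>d. \<forall>m\<in>Poly_Mapping.keys p. (\<Sum>i\<in>Poly_Mapping.keys m. Poly_Mapping.lookup m i) = d)"

text \<open>The polynomials of a homogeneous system may have different degrees.\<close>

definition homogeneous_system :: "mpoly list \<Rightarrow> bool" where
  "homogeneous_system \<sigma> \<longleftrightarrow> (\<forall>p\<in>set \<sigma>. homogeneous p)"

definition system_zero :: "mpoly list \<Rightarrow> (nat \<Rightarrow> real) \<Rightarrow> bool" where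
  "system_zero \<sigma> a \<longleftrightarrow> (\<forall>p\<in>set \<sigma>. poly_eval p a = 0)"

definition coeff_field :: "real set \<Rightarrow> real set" where
  "coeff_field T = (if T = UNIV then UNIV else \<rat>)"

definition partition_regular :: "real set \<Rightarrow> nat \<Rightarrow> mpoly list \<Rightarrow> bool" where
  "partition_regular S n \<sigma> \<longleftrightarrow>
     (\<forall>P. finite P \<and> partition_on (S - {0}) P \<longrightarrow>
        (\<exists>A\<in>P. \<exists>a. (\<forall>i\<in>{1..n}. a i \<in> A) \<and> system_zero \<sigma> a))"

text \<open>A filter \<open>F\<close> on \<open>S\<close> is rendered as a library filter with \<open>F \<le> principal S\<close>;
  the following is the corresponding family of subsets of \<open>S\<close>.\<close>

definition filter_sets :: "'a set \<Rightarrow> 'a filter \<Rightarrow> 'a set set" where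
  "filter_sets S F = {A. A \<subseteq> S \<and> eventually (\<lambda>x. x \<in> A) F}"

text \<open>Here, in contrast to \<^const>\<open>partition_regular\<close>, the element \<open>0\<close> is not removed from \<open>S\<close>.\<close>

definition filter_partition_regular ::
    "real filter \<Rightarrow> real set \<Rightarrow> nat \<Rightarrow> mpoly list \<Rightarrow> bool" where
  "filter_partition_regular F S n \<sigma> \<longleftrightarrow>
     (\<forall>V\<in>filter_sets S F. \<forall>P. finite P \<and> partition_on S P \<longrightarrow>
        (\<exists>A\<in>P. \<exists>a. (\<forall>i\<in>{1..n}. a i \<in> A \<inter> V) \<and> system_zero \<sigma> a))"

definition piecewise_syndetic :: "'a::times set \<Rightarrow> 'a set \<Rightarrow> bool" where
  "piecewise_syndetic S A \<longleftrightarrow>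
     A \<subseteq> S \<and>
     (\<exists>G. finite G \<and> G \<noteq> {} \<and> G \<subseteq> S \<and>
       (\<forall>H. finite H \<and> H \<subseteq> S \<longrightarrow>
         (\<exists>x\<in>S. (\<lambda>h. h * x) ` H \<subseteq> (\<Union>t\<in>G. {y \<in> S. t * y \<in> A}))))"

end

(* Write V for a member of the filter, with witness G of piecewise syndeticity, and let P be a finite
   partition of S. For each finite H there is x with every h x (h in H) moved into V by some t in G;
   colour h by such a t and by the cell of P containing t h x. These finite colourings have a limit
   colouring f of S (compactness), and partition regularity gives an f-monochromatic solution a.
   Choosing H so that its colouring agrees with f on the values of a, the homogeneous rescaling
   t x a is a solution inside V and a single cell of P. *)
theory Submission
  imports Defs "HOL-Analysis.Function_Topology"
begin

text \<open>By Tychonoff, the maps from \<open>S\<close> to the finite discrete \<open>C\<close>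
  form a compact space. For finite \<open>J\<close>, those agreeing on \<open>J\<close> with some
  \<open>c H\<close>, where \<open>H\<close> contains \<open>J\<close>, form a closed set
  \<open>K J\<close>. These sets have the finite intersection property, and any common point serves
  as \<open>f\<close>.\<close>

lemma rado_selection:
  fixes S :: "'a set" and C :: "'b set" and c :: "'a set \<Rightarrow> 'a \<Rightarrow> 'b"
  assumes "finite C"
    and c: "\<And>H h. finite H \<Longrightarrow> H \<subseteq> S \<Longrightarrow> h \<in> H \<Longrightarrow> c H h \<in> C"
  shows "\<exists>f\<in>S \<rightarrow> C. \<forall>J. finite J \<and> J \<subseteq> S \<longrightarrow>
           (\<exists>H. finite H \<and> J \<subseteq> H \<and> H \<subseteq> S \<and> (\<forall>j\<in>J. c H j = f j))"
proof -
  define X where "X = product_topology (\<lambda>_. discrete_topology C) S"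
  have top: "topspace X = (S \<rightarrow>\<^sub>E C)"
    by (simp add: X_def)
  define K where "K J = {f \<in> S \<rightarrow>\<^sub>E C.
    \<exists>H. finite H \<and> J \<subseteq> H \<and> H \<subseteq> S \<and> (\<forall>j\<in>J. c H j = f j)}" for J
  have compact: "compact_space X"
    using \<open>finite C\<close> by (simp add: X_def compact_space_product_topology compact_space_discrete_topology)
  have closed: "closedin X (K J)" if J: "finite J" "J \<subseteq> S" for J
  proof -
    have "\<exists>U. openin X U \<and> f \<in> U \<and> U \<subseteq> topspace X - K J"
      if f: "f \<in> topspace X - K J" for f
    proof (intro exI conjI)
      \<comment> \<open>Membership in \<open>K J\<close> depends only on the values on
        \<open>J\<close>, so the cylinder of maps agreeing with \<open>f\<close> on \<open>J\<close>
        avoids \<open>K J\<close> as \<open>f\<close> does.\<close>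
      let ?U = "\<Pi>\<^sub>E i\<in>S. if i \<in> J then {f i} else C"
      have "finite {i \<in> S. (if i \<in> J then {f i} else C) \<noteq> C}"
        by (rule finite_subset[OF _ J(1)]) auto
      then show "openin X ?U"
        using f by (auto simp: X_def openin_PiE_gen)
      show "f \<in> ?U"
        using f by (auto simp: top PiE_iff)
      show "?U \<subseteq> topspace X - K J"
      proof
        fix g assume g: "g \<in> ?U"
        have "?U \<subseteq> (S \<rightarrow>\<^sub>E C)"
          using f by (intro PiE_mono) (auto simp: top)
        with g have "g \<in> S \<rightarrow>\<^sub>E C"
          by (rule subsetD[rotated])
        moreover have "g j = f j" if "j \<in> J" for j
          using PiE_mem[OF g, of j] J that by auto
        ultimately show "g \<in> topspace X - K J"
          using f by (auto simp: K_def top)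
      qed
    qed
    then have "openin X (topspace X - K J)"
      by (subst openin_subopen) blast
    then show ?thesis
      by (auto simp: closedin_def top K_def)
  qed
  have fip: "\<Inter>\<F> \<noteq> {}"
    if "finite \<F>" and sub: "\<F> \<subseteq> K ` {J. finite J \<and> J \<subseteq> S}" for \<F>
  proof -
    obtain \<J> where \<J>: "\<J> \<subseteq> {J. finite J \<and> J \<subseteq> S}" "finite \<J>" "\<F> = K ` \<J>"
      using finite_subset_image[OF \<open>finite \<F>\<close> sub] by blast
    \<comment> \<open>A single \<open>H\<close> containing every \<open>J\<close> in the subfamily
      witnesses all the conditions at once.\<close>
    define H where "H = \<Union>\<J>"
    have H: "finite H" "H \<subseteq> S"
      using \<J> by (auto simp: H_def)
    \<comment> \<open>Outside \<open>H\<close>, the value \<open>c {i} i\<close> only serves to stay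
      in \<open>C\<close>.\<close>
    define g where "g = (\<lambda>i\<in>S. if i \<in> H then c H i else c {i} i)"
    have "g \<in> S \<rightarrow>\<^sub>E C"
      using H by (auto simp: g_def intro!: c)
    moreover have "\<forall>j\<in>H. c H j = g j"
      using H by (auto simp: g_def)
    ultimately have "g \<in> K J" if "J \<in> \<J>" for J
      using H that unfolding K_def H_def by blast
    then show ?thesis
      using \<J>(3) by blast
  qed
  have "\<Inter>(K ` {J. finite J \<and> J \<subseteq> S}) \<noteq> {}"
    by (rule compact[unfolded compact_space_fip, rule_format]) (use closed fip in auto)
  then obtain f where f: "f \<in> K J" if "finite J" "J \<subseteq> S" for J
    by blast
  show ?thesis
  proof (intro bexI[of _ f] allI impI)
    show "f \<in> S \<rightarrow> C"
      using f[of "{}"] by (auto simp: K_def)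
    show "\<exists>H. finite H \<and> J \<subseteq> H \<and> H \<subseteq> S \<and> (\<forall>j\<in>J. c H j = f j)"
      if "finite J \<and> J \<subseteq> S" for J
      using f[of J] that by (simp add: K_def)
  qed
qed

lemma poly_eval_scale:
  assumes "\<And>m. m \<in> Poly_Mapping.keys p \<Longrightarrow>
             (\<Sum>i\<in>Poly_Mapping.keys m. Poly_Mapping.lookup m i) = d"
  shows "poly_eval p (\<lambda>i. r * a i) = r ^ d * poly_eval p a"
  unfolding poly_eval_def sum_distrib_left
proof (rule sum.cong)
  fix m assume "m \<in> Poly_Mapping.keys p"
  then have "(\<Prod>i\<in>Poly_Mapping.keys m. r ^ Poly_Mapping.lookup m i) = r ^ d"
    by (simp add: power_sum[symmetric] assms)
  then show "Poly_Mapping.lookup p m *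
        (\<Prod>i\<in>Poly_Mapping.keys m. (r * a i) ^ Poly_Mapping.lookup m i) =
      r ^ d * (Poly_Mapping.lookup p m *
        (\<Prod>i\<in>Poly_Mapping.keys m. a i ^ Poly_Mapping.lookup m i))"
    by (simp add: power_mult_distrib prod.distrib)
qed simp

text \<open>Each polynomial picks up its own power of \<open>r\<close>, so the degrees may differ
  within the system. The factor \<open>r = 0\<close> is allowed and yields the zero solution from
  any solution.\<close>

lemma system_zero_scale:
  assumes "homogeneous_system \<sigma>" and "system_zero \<sigma> a"
  shows "system_zero \<sigma> (\<lambda>i. r * a i)"
  unfolding system_zero_def
proof
  fix p assume p: "p \<in> set \<sigma>"
  then obtain d where "\<And>m. m \<in> Poly_Mapping.keys p \<Longrightarrow>
      (\<Sum>i\<in>Poly_Mapping.keys m. Poly_Mapping.lookup m i) = d"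
    using assms(1) unfolding homogeneous_system_def homogeneous_def by meson
  then show "poly_eval p (\<lambda>i. r * a i) = 0"
    using assms(2) p by (simp add: poly_eval_scale system_zero_def)
qed

text \<open>This turns a colouring into a partition to which partition regularity applies; empty
  fibres are dropped because cells must be nonempty.\<close>

lemma partition_on_fibres:
  assumes "f \<in> S \<rightarrow> C"
  shows "partition_on S ((\<lambda>q. {s \<in> S. f s = q}) ` C - {{}})"
proof (rule partition_onI)
  show "\<Union>((\<lambda>q. {s \<in> S. f s = q}) ` C - {{}}) = S"
    using assms by (auto simp: Pi_iff)
qed (auto simp: disjnt_iff)

text \<open>The conclusion of the theorem concerns one member of the filter at a time, so a single
  piecewise syndetic \<open>V\<close> is treated.\<close>

lemma piecewise_syndetic_partition_regular:
  assumes hom: "homogeneous_system \<sigma>" and reg: "partition_regular S n \<sigma>"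
    and V: "piecewise_syndetic S V" and P: "finite P" "partition_on S P"
  shows "\<exists>A\<in>P. \<exists>a. (\<forall>i\<in>{1..n}. a i \<in> A \<inter> V) \<and> system_zero \<sigma> a"
proof -
  obtain G where G: "finite G" "G \<noteq> {}" "G \<subseteq> S"
    and G_synd: "\<forall>H. finite H \<and> H \<subseteq> S \<longrightarrow>
           (\<exists>x\<in>S. (\<lambda>h. h * x) ` H \<subseteq> (\<Union>t\<in>G. {y \<in> S. t * y \<in> V}))"
    using V unfolding piecewise_syndetic_def by meson
  have "\<exists>x. \<forall>h\<in>H. \<exists>t\<in>G. t * (h * x) \<in> V" if H: "finite H" "H \<subseteq> S" for H
  proof -
    obtain x where "(\<lambda>h. h * x) ` H \<subseteq> (\<Union>t\<in>G. {y \<in> S. t * y \<in> V})"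
      using G_synd[rule_format, OF conjI[OF H]] ..
    then show ?thesis
      by (intro exI[of _ x]) blast
  qed
  then obtain x where x: "\<And>H h. finite H \<Longrightarrow> H \<subseteq> S \<Longrightarrow> h \<in> H \<Longrightarrow>
      \<exists>t\<in>G. t * (h * x H) \<in> V"
    by metis
  have "V \<subseteq> S"
    using V by (simp add: piecewise_syndetic_def)
  have cover: "\<Union>P = S"
    using P(2) by (simp add: partition_on_def)
  show ?thesis
  proof (cases "0 \<in> S")
    case True
    \<comment> \<open>Taking \<open>0 \<in> H\<close> in the definition of piecewise syndeticity forces \<open>0 \<in> V\<close>,
      and then the zero assignment is a solution.\<close>
    then have "0 \<in> V"
      using x[of "{0}"] by auto
    obtain A where A: "A \<in> P" "0 \<in> A"
      using True cover by blast
    \<comment> \<open>If \<open>S = {0}\<close>, the empty partition of \<open>S - {0}\<close> has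
      no cell and contradicts partition regularity; otherwise the one-cell partition gives a
      solution.\<close>
    obtain a where "system_zero \<sigma> a"
    proof (cases "S - {0} = {}")
      case True
      then show ?thesis
        using reg that by (auto simp: partition_regular_def partition_on_def)
    next
      case False
      then show ?thesis
        using reg that partition_on_space[OF False] unfolding partition_regular_def
        by (metis finite.emptyI finite.insertI)
    qed
    then have "system_zero \<sigma> (\<lambda>i. 0)"
      using system_zero_scale[OF hom, of a 0] by simp
    then show ?thesis
      using A \<open>0 \<in> V\<close> by auto
  next
    case False
    have "\<exists>q. q \<in> G \<times> P \<and> fst q * (h * x H) \<in> snd q \<inter> V"
      if H: "finite H" "H \<subseteq> S" "h \<in> H" for H h
    proof -
      obtain t where "t \<in> G" "t * (h * x H) \<in> V"
        using x[OF H] by blast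
      moreover obtain A where "A \<in> P" "t * (h * x H) \<in> A"
        using calculation \<open>V \<subseteq> S\<close> cover by blast
      ultimately show ?thesis
        by (intro exI[of _ "(t, A)"]) auto
    qed
    then obtain c where c: "\<And>H h. finite H \<Longrightarrow> H \<subseteq> S \<Longrightarrow> h \<in> H \<Longrightarrow>
        c H h \<in> G \<times> P \<and> fst (c H h) * (h * x H) \<in> snd (c H h) \<inter> V"
      by metis
    have fin: "finite (G \<times> P)"
      using G(1) P(1) by simp
    have cGP: "c H h \<in> G \<times> P" if "finite H" "H \<subseteq> S" "h \<in> H" for H h
      using c[OF that] by (rule conjunct1)
    obtain f where f: "f \<in> S \<rightarrow> G \<times> P"
      and sel: "\<forall>J. finite J \<and> J \<subseteq> S \<longrightarrow>
        (\<exists>H. finite H \<and> J \<subseteq> H \<and> H \<subseteq> S \<and> (\<forall>j\<in>J. c H j = f j))"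
      using rado_selection[of "G \<times> P" S c, OF fin cGP] ..
    let ?Q = "(\<lambda>q. {s \<in> S. f s = q}) ` (G \<times> P) - {{}}"
    \<comment> \<open>Here \<open>S - {0} = S\<close>, so the fibres of \<open>f\<close> partition
      the set on which partition regularity is stated.\<close>
    have "finite ?Q" "partition_on (S - {0}) ?Q"
      using fin partition_on_fibres[OF f] False by auto
    then obtain B a where B: "B \<in> ?Q" "\<forall>i\<in>{1..n}. a i \<in> B" and a: "system_zero \<sigma> a"
      using reg unfolding partition_regular_def by meson
    then obtain t A where tA: "t \<in> G" "A \<in> P" "B = {s \<in> S. f s = (t, A)}"
      by auto
    have "finite (a ` {1..n})" "a ` {1..n} \<subseteq> S"
      using B tA by auto
    \<comment> \<open>\<open>H\<close> is chosen only after \<open>a\<close>: all values of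
      \<open>a\<close> then have the same colour \<open>(t, A)\<close> under \<open>c H\<close>, and
      the common factor \<open>t * x H\<close> moves each of them into \<open>A\<close> and
      \<open>V\<close>.\<close>
    then obtain H where H: "finite H" "a ` {1..n} \<subseteq> H" "H \<subseteq> S"
      and eq: "\<forall>j\<in>a ` {1..n}. c H j = f j"
      using sel[rule_format, of "a ` {1..n}"] by auto
    have "(t * x H) * a i \<in> A \<inter> V" if i: "i \<in> {1..n}" for i
    proof -
      have "c H (a i) = (t, A)"
        using eq B(2) i tA(3) by auto
      moreover have "a i \<in> H"
        using H(2) i by blast
      ultimately show ?thesis
        using c[OF H(1,3), of "a i"] by (simp add: mult_ac)
    qed
    moreover have "system_zero \<sigma> (\<lambda>i. (t * x H) * a i)"
      by (rule system_zero_scale[OF hom a])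
    ultimately show ?thesis
      by (intro bexI[OF _ tA(2)] exI[of _ "\<lambda>i. (t * x H) * a i"]) auto
  qed
qed

theorem corollary7p6:
  fixes T S :: "real set" and F :: "real filter"
  assumes "T \<in> {\<nat>, \<int>, \<rat>, UNIV}"
    and "S \<subseteq> T"
    and "\<And>x y. x \<in> S \<Longrightarrow> y \<in> S \<Longrightarrow> x * y \<in> S"
    and "F \<noteq> bot" and "F \<le> principal S"
    and "\<And>A. A \<in> filter_sets S F \<Longrightarrow> piecewise_syndetic S A"
  shows "\<forall>n \<sigma>. set \<sigma> \<subseteq> polys_over (coeff_field T) n \<and> homogeneous_system \<sigma> \<and>
           partition_regular S n \<sigma> \<longrightarrow> filter_partition_regular F S n \<sigma>"
  unfolding filter_partition_regular_def
proof (intro allI impI ballI; elim conjE)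
  fix n \<sigma> V P
  assume V: "V \<in> filter_sets S F"
    and "homogeneous_system \<sigma>" "partition_regular S n \<sigma>" "finite P" "partition_on S P"
  then show "\<exists>A\<in>P. \<exists>a. (\<forall>i\<in>{1..n}. a i \<in> A \<inter> V) \<and> system_zero \<sigma> a"
    using piecewise_syndetic_partition_regular assms(6)[OF V] by metis
qed

end
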